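(* Let $q>4$ be a prime power. Then there exists $b\in\mathbb{F}_{q^2}^*$ such that $$U_{b,1}=\{(x,bx^q+x^{q^4})\colon x\in\mathbb{F}_{q^6}\}$$ is a maximum scattered $\mathbb{F}_q$-subspace of $\mathbb{F}_{q^6}\times\mathbb{F}_{q^6}$.
   Context: An $\mathbb{F}_q$-subspace $U$ of $\mathbb{F}_{q^m}\times\mathbb{F}_{q^m}$ is scattered if $\dim_{\mathbb{F}_q}(\langle \mathbf{v}\rangle_{\mathbb{F}_{q^m}}\cap U)\leq 1$ for every nonzero $\mathbf{v}\in\mathbb{F}_{q^m}\times\mathbb{F}_{q^m}$. It is maximum scattered if it is scattered and has the largest possible $\mathbb{F}_q$-dimension among scattered $\mathbb{F}_q$-subspaces of $\mathbb{F}_{q^m}\times\mathbb{F}_{q^m}$; this largest dimension is $m$. *)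

theory Defs
  imports
    "HOL-Library.Cardinality"
    "HOL-Library.Product_Plus"
    "HOL-Number_Theory.Prime_Powers"
    "Jordan_Normal_Form.Matrix"  (* for the locale field_hom between type-class fields *)
begin

text \<open>
  A field extension is given by a field homomorphism \<open>\<iota>\<close> from the small field (a type \<open>'k\<close>)
  into the large one (a type \<open>'l\<close>). Restriction of scalars along \<open>\<iota>\<close> makes
  \<open>'l \<times> 'l\<close> a vector space over \<open>'k\<close>; \<open>\<iota> = id\<close> gives its structure over \<open>'l\<close> itself.
\<close>

definition scale2 :: "('k \<Rightarrow> 'l) \<Rightarrow> 'k \<Rightarrow> 'l \<times> 'l \<Rightarrow> 'l \<times> 'l::field" where
  "scale2 \<iota> c v = (\<iota> c * fst v, \<iota> c * snd v)"

lemma vector_space_scale2: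
  fixes \<iota> :: "'k::field \<Rightarrow> 'l::field"
  assumes "field_hom \<iota>"
  shows "vector_space (scale2 \<iota>)"
proof -
  interpret field_hom \<iota> by fact
  show ?thesis
    by unfold_locales
      (auto simp: scale2_def prod_eq_iff hom_add hom_mult algebra_simps)
qed

lemma vector_space_scale2_id: "vector_space (scale2 (id :: 'l \<Rightarrow> 'l::field))"
  by unfold_locales (auto simp: scale2_def prod_eq_iff algebra_simps)

definition scattered :: "('k::field \<Rightarrow> 'l::field) \<Rightarrow> ('l \<times> 'l) set \<Rightarrow> bool" where
  "scattered \<iota> U \<longleftrightarrow>
     module.subspace (scale2 \<iota>) U \<and>
     (\<forall>v. v \<noteq> 0 \<longrightarrow> vector_space.dim (scale2 \<iota>) (module.span (scale2 id) {v} \<inter> U) \<le> 1)"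

definition maximum_scattered :: "('k::field \<Rightarrow> 'l::field) \<Rightarrow> ('l \<times> 'l) set \<Rightarrow> bool" where
  "maximum_scattered \<iota> U \<longleftrightarrow>
     scattered \<iota> U \<and>
     (\<forall>W. scattered \<iota> W \<longrightarrow> vector_space.dim (scale2 \<iota>) W \<le> vector_space.dim (scale2 \<iota>) U)"

end

theory Submission
  imports Defs "HOL-Computational_Algebra.Polynomial"
begin

text \<open>
  Write \<open>\<phi> x = x\<^sup>q\<close> and \<open>N = b\<^bsup>q+1\<^esup>\<close>. If a vector of the subspace and its multiple by \<open>c\<close> both lie in
  \<open>U\<close>, eliminating \<open>x\<close> with the help of \<open>\<phi>\<^sup>3\<close> gives a cross-ratio equation with value \<open>N\<close> for the two
  pairs \<open>{c, \<phi>\<^sup>3 c}\<close> and \<open>{\<phi> c, \<phi>\<^sup>4 c}\<close>; applying \<open>\<phi>\<close> yields the same for the other two couples among the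
  three pairs \<open>{\<phi>\<^sup>i c, \<phi>\<^bsup>i+3\<^esup> c}\<close>. Sending the first pair to \<open>{\<infinity>, 0}\<close>, these equations force
  a ratio \<open>r\<close> of the remaining points to satisfy \<open>r\<^sup>2 - (N + 1) r + 1 = 0\<close>. When
  \<open>N = (t\<^sup>2 - t + 1) / (t (t - 1))\<close> with \<open>t\<close> fixed by \<open>\<phi>\<close>, the roots are \<open>t / (t - 1)\<close> and its
  inverse, so \<open>r\<close> is fixed by \<open>\<phi>\<close>; but \<open>\<phi>\<^sup>3\<close> turns \<open>r\<close> into \<open>1 / r\<close>, hence \<open>r\<^sup>2 = 1\<close>, which the
  choice of \<open>t\<close> excludes unless \<open>\<phi> c = c\<close>. Maximality is a count of nonzero vectors on the \<open>q\<^sup>6 + 1\<close> lines.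
\<close>

section \<open>Finite fields: Frobenius maps, fixed fields and norms\<close>

lemma power_CARD_eq_self:
  fixes x :: "'a :: {field,finite}"
  shows "x ^ CARD('a) = x"
proof (cases "x = 0")
  case False
  have "(\<Prod>y\<in>UNIV-{0}. x * y) = \<Prod>(UNIV-{0})"
    by (rule prod.reindex_bij_witness[of _ "\<lambda>y. y / x" "\<lambda>y. x * y"]) (use False in auto)
  then have "x ^ (CARD('a) - 1) = 1"
    by (simp add: prod.distrib)
  moreover have "CARD('a) = Suc (CARD('a) - 1)"
    by (simp add: finite_UNIV_card_ge_0)
  ultimately show ?thesis
    by (metis mult.right_neutral power_Suc)
qed (simp add: finite_UNIV_card_ge_0)

lemma power_eq_self_iff:
  fixes x :: "'a :: field"
  assumes "n > 0"
  shows "x ^ n = x \<longleftrightarrow> x = 0 \<or> x ^ (n - 1) = 1"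
  using assms by (cases n) auto

lemma card_power_eq_le:
  fixes c :: "'a :: field"
  assumes "n > 0"
  shows "card {x. x ^ n = c} \<le> n"
proof -
  let ?p = "monom 1 n - [:c:]"
  have "coeff ?p n = 1"
    using assms by (simp add: coeff_pCons split: nat.split)
  then have "?p \<noteq> 0"
    by (metis coeff_0 zero_neq_one)
  then have "card {x. poly ?p x = 0} \<le> degree ?p"
    by (rule card_poly_roots_bound)
  also have "\<dots> \<le> n"
    by (intro degree_diff_le) (simp_all add: degree_monom_le)
  finally have "card {x. poly ?p x = 0} \<le> n" .
  then show ?thesis
    by (simp add: poly_monom)
qed

lemma CHAR_dvd_CARD: "CHAR('a :: {ring_1,finite}) dvd CARD('a)"
proof -
  have "(\<Sum>x\<in>(UNIV :: 'a set). x + 1) = \<Sum>UNIV"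
    by (rule sum.reindex_bij_witness[of _ "\<lambda>x. x - 1" "\<lambda>x. x + 1"]) auto
  then have "of_nat CARD('a) = (0 :: 'a)"
    by (simp add: sum.distrib)
  then show ?thesis
    by (simp add: of_nat_eq_0_iff_char_dvd)
qed

text \<open>The characteristic divides \<open>q ^ n\<close>, hence is the prime of which
  \<open>q\<close> is a power, and the freshman's dream applies.\<close>

lemma add_power_primepow:
  fixes x y :: "'a :: {field,finite}"
  assumes "primepow q" and "CARD('a) = q ^ n"
  shows "(x + y) ^ q = x ^ q + y ^ q"
proof -
  obtain p k where p: "prime p" "q = p ^ k"
    using assms(1) by (auto simp: primepow_def)
  have prime: "prime CHAR('a)"
    by (simp add: finite_imp_CHAR_pos prime_CHAR_semidom)
  have "CHAR('a) dvd q ^ n"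
    using CHAR_dvd_CARD[where 'a='a] assms by simp
  then have "CHAR('a) = p"
    using prime p by (metis prime_dvd_power primes_dvd_imp_eq)
  then show ?thesis
    using freshmans_dream'[OF prime] p by simp
qed

lemma field_hom_power_primepow:
  assumes "primepow q" and "CARD('a) = q ^ n"
  shows "field_hom (\<lambda>x :: 'a :: {field,finite}. x ^ q)"
proof -
  have "q > 0"
    using primepow_gt_Suc_0[OF assms(1)] by simp
  then show ?thesis
    by unfold_locales (use add_power_primepow[OF assms] in \<open>auto simp: power_mult_distrib\<close>)
qed

text \<open>The image consists of roots of \<open>x ^ CARD('k) = x\<close>; by injectivity it
  already has \<open>CARD('k)\<close> elements, the most that the number of roots allows.\<close>

lemma range_field_hom_eq_power_fixed:
  fixes \<iota> :: "'k :: {field,finite} \<Rightarrow> 'l :: {field,finite}"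
  assumes "field_hom \<iota>"
  shows "range \<iota> = {x. x ^ CARD('k) = x}"
proof -
  interpret \<iota>: field_hom \<iota> by fact
  let ?q = "CARD('k)"
  have q: "?q > 1"
    using card_mono[of UNIV "{0, 1 :: 'k}"] by simp
  have sub: "range \<iota> \<subseteq> {x. x ^ ?q = x}"
    using power_CARD_eq_self by (auto simp: \<iota>.hom_power[symmetric])
  have "{x :: 'l. x ^ ?q = x} \<subseteq> insert 0 {x. x ^ (?q - 1) = 1}"
    using q by (auto simp: power_eq_self_iff)
  then have "card {x :: 'l. x ^ ?q = x} \<le> card (insert 0 {x :: 'l. x ^ (?q - 1) = 1})"
    by (intro card_mono) auto
  also have "\<dots> \<le> Suc (card {x :: 'l. x ^ (?q - 1) = 1})"
    by (simp add: card_insert_if)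
  also have "\<dots> \<le> ?q"
    using card_power_eq_le[of "?q - 1" "1 :: 'l"] q by simp
  also have "\<dots> = card (range \<iota>)"
    by (simp add: card_image \<iota>.inj_f)
  finally show ?thesis
    using card_seteq[OF _ sub] by simp
qed

text \<open>Pigeonhole: norm fibres have at most \<open>q + 1\<close> elements, so the nonzero
  elements of the field of order \<open>q\<^sup>2\<close> have at least \<open>q - 1\<close> norms.
  These all solve \<open>y ^ (q - 1) = 1\<close>, which has at most \<open>q - 1\<close>
  solutions.\<close>

lemma norm_surjective:
  fixes \<kappa> :: "'k :: {field,finite} \<Rightarrow> 'l :: {field,finite}"
  assumes "field_hom \<kappa>" and "CARD('k) = q\<^sup>2" and "c ^ q = c" and "c \<noteq> 0"
  obtains b where "b \<in> range \<kappa>" "b ^ (q + 1) = c"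
proof -
  interpret \<kappa>: field_hom \<kappa> by fact
  let ?B = "(\<lambda>x. x ^ (q + 1)) ` (UNIV - {0 :: 'k})"
  let ?A = "\<kappa> ` ?B"
  let ?T = "{y :: 'l. y ^ (q - 1) = 1}"
  have "1 < CARD('k)"
    using card_mono[of UNIV "{0, 1 :: 'k}"] by simp
  then have q: "q > 1"
    using assms(2) by (metis One_nat_def less_one linorder_neqE_nat one_power2 zero_power2 not_less_zero)
  have sub: "?A \<subseteq> ?T"
  proof
    fix y assume "y \<in> ?A"
    then obtain x where x: "x \<noteq> 0" "y = \<kappa> x ^ (q + 1)"
      using \<kappa>.hom_power by blast
    have "x ^ (q\<^sup>2 - 1) = 1"
      using power_CARD_eq_self[of x] assms(2) q x(1) by (simp add: power_eq_self_iff)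
    moreover have "(q + 1) * (q - 1) = q\<^sup>2 - 1"
      by (simp add: algebra_simps power2_eq_square)
    ultimately have "\<kappa> x ^ ((q + 1) * (q - 1)) = 1"
      by (metis \<kappa>.hom_one \<kappa>.hom_power)
    then show "y \<in> ?T"
      using x(2) by (simp only: power_mult mem_Collect_eq)
  qed
  have fin: "finite ?T" by simp
  have "(q - 1) * (q + 1) = card (UNIV - {0 :: 'k})"
    by (simp add: assms(2) algebra_simps power2_eq_square)
  also have "\<dots> \<le> card (\<Union>y\<in>?B. {x. x ^ (q + 1) = y})"
    by (rule card_mono[OF finite]) blast
  also have "\<dots> \<le> (\<Sum>y\<in>?B. card {x. x ^ (q + 1) = y})"
    by (rule card_UN_le) simp
  also have "\<dots> \<le> of_nat (card ?B) * (q + 1)"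
    by (intro sum_bounded_above card_power_eq_le) simp
  also have "card ?B = card ?A"
    by (intro card_image[symmetric] inj_on_subset[OF \<kappa>.inj_f]) simp
  finally have "q - 1 \<le> card ?A"
    by (simp only: of_nat_id mult_le_cancel2)
  moreover have "card ?T \<le> q - 1"
    using q by (intro card_power_eq_le) simp
  ultimately have "?A = ?T"
    using card_seteq[OF fin sub] by simp
  moreover have "c \<in> ?T"
    using assms(3,4) q by (simp add: power_eq_self_iff)
  ultimately have "c \<in> ?A"
    by (simp only:)
  then obtain x where "c = \<kappa> (x ^ (q + 1))"
    by blast
  then show ?thesis
    using that[of "\<kappa> x"] by (simp only: \<kappa>.hom_power rangeI simp_thms)
qed

text \<open>The excluded values are roots of a polynomial of degree at most 5, so more than five
  elements leave room for \<open>t\<close>. Order five is settled by a witness.\<close>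

lemma exists_norm_parameter:
  assumes "CARD('a :: {field,finite}) > 4"
  obtains t :: "'a :: {field,finite}" where "t \<noteq> 0" "t \<noteq> 1" "t\<^sup>2 \<noteq> (t - 1)\<^sup>2" "t\<^sup>2 - t + 1 \<noteq> 0"
proof (cases "CARD('a) = 5")
  case True
  have "CHAR('a) dvd 5"
    using CHAR_dvd_CARD[where 'a='a] True by simp
  then have five: "(5 :: 'a) = 0"
    using of_nat_eq_0_iff_char_dvd[where 'a='a, of 5] by simp
  \<comment> \<open>For the witness 2 the four conditions become that 2, 3 are nonzero and 2, 4
    differ from 1.\<close>
  have "(2 :: 'a) \<noteq> 0"
  proof
    assume "(2 :: 'a) = 0"
    then have "(5 :: 'a) - 2 * 2 = 0" using five by simp
    then show False by simp
  qed
  moreover have "(3 :: 'a) \<noteq> 0"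
  proof
    assume "(3 :: 'a) = 0"
    then have "2 * (3 :: 'a) - 5 = 0" using five by simp
    then show False by simp
  qed
  moreover have "(4 :: 'a) \<noteq> 1"
  proof
    assume "(4 :: 'a) = 1"
    then have "(4 :: 'a) - 1 = 0" by simp
    with \<open>(3 :: 'a) \<noteq> 0\<close> show False by simp
  qed
  moreover have "(2 :: 'a) \<noteq> 1"
    by (metis add_cancel_right_right one_add_one zero_neq_one)
  ultimately show ?thesis
    using that[of 2] by simp
next
  case False
  \<comment> \<open>The factor \<open>[:-1, 2:]\<close> is
    \<open>t\<^sup>2 - (t - 1)\<^sup>2\<close> with its square terms cancelled; it remains nonzero
    in characteristic 2.\<close>
  let ?p = "[:0, 1:] * [:-1, 1:] * [:-1, 2:] * [:1, -1, 1 :: 'a:]"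
  have "?p \<noteq> 0" by (simp only: mult_eq_0_iff) simp
  then have "card {x. poly ?p x = 0} \<le> degree ?p"
    by (rule card_poly_roots_bound)
  also have "degree ?p \<le> 5"
    by (intro order.trans[OF degree_mult_le] ) simp
  finally have "{x. poly ?p x = 0} \<noteq> UNIV"
    using assms False by auto
  then obtain t where t: "poly ?p t \<noteq> 0" by blast
  have "poly ?p t = t * (t - 1) * (t\<^sup>2 - (t - 1)\<^sup>2) * (t\<^sup>2 - t + 1)"
    by (simp add: power2_eq_square algebra_simps)
  with t show ?thesis
    by (intro that[of t]) auto
qed

section \<open>Cardinalities of subspaces and the dimension bound for scattered ones\<close>

lemma card_span_independent:
  fixes scale :: "'k :: {field,finite} \<Rightarrow> 'v :: ab_group_add \<Rightarrow> 'v"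
  assumes "vector_space scale" and "finite B" and "\<not> module.dependent scale B"
  shows "card (module.span scale B) = CARD('k) ^ card B"
proof -
  interpret vector_space scale by fact
  from assms(2,3) show ?thesis
  proof (induction B rule: finite_induct)
    case (insert a B)
    then have ind: "independent B" "a \<notin> span B"
      by (auto simp: independent_insert)
    have eq: "span (insert a B) = (\<lambda>(k, x). scale k a + x) ` (UNIV \<times> span B)"
    proof safe
      fix x assume "x \<in> span (insert a B)"
      then obtain k where "x - scale k a \<in> span B"
        by (auto simp: span_insert)
      then show "x \<in> (\<lambda>(k, x). scale k a + x) ` (UNIV \<times> span B)"
        by (intro image_eqI[of _ _ "(k, x - scale k a)"]) auto
    next
      fix k x assume "x \<in> span B"
      then show "scale k a + x \<in> span (insert a B)"
        by (auto simp: span_insert intro!: exI[of _ k])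
    qed
    have "inj_on (\<lambda>(k, x). scale k a + x) (UNIV \<times> span B)"
    proof (rule inj_onI, clarify)
      fix k x l y
      assume xy: "x \<in> span B" "y \<in> span B" and e: "scale k a + x = scale l a + y"
      have "scale (k - l) a = y - x"
        using e by (simp add: algebra_simps)
      with xy have "scale (k - l) a \<in> span B"
        by (simp add: span_diff)
      with ind(2) have "k = l"
        using span_scale[of "scale (k - l) a" B "inverse (k - l)"] by (cases "k = l") auto
      with e show "k = l \<and> x = y" by simp
    qed
    with eq show ?case
      using insert ind by (simp add: card_image card_cartesian_product)
  qed simp
qed

lemma card_subspace:
  fixes scale :: "'k :: {field,finite} \<Rightarrow> 'v :: {ab_group_add,finite} \<Rightarrow> 'v"
  assumes "vector_space scale" and "module.subspace scale W"
  shows "card W = CARD('k) ^ vector_space.dim scale W"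
proof -
  interpret vector_space scale by fact
  obtain B where B: "B \<subseteq> W" "independent B" "W \<subseteq> span B" "card B = dim W"
    using basis_exists .
  then have "span B = W"
    using assms(2) by (simp add: span_subspace)
  then show ?thesis
    using card_span_independent[OF assms(1) _ B(2)] B(4) by simp
qed

lemma span_scale2_id: "module.span (scale2 id) {v} = range (\<lambda>c. scale2 id c v)"
proof -
  interpret vector_space "scale2 (id :: 'a \<Rightarrow> _)"
    by (rule vector_space_scale2_id)
  show ?thesis by (rule span_singleton)
qed

text \<open>Any nonzero vector of the intersection with a line spans it over the small field,
  because all other vectors there are multiples by factors from
  \<open>range \<iota>\<close>.\<close>

lemma scatteredI:
  fixes \<iota> :: "'k :: field \<Rightarrow> 'l :: field"
  assumes "field_hom \<iota>" and "module.subspace (scale2 \<iota>) U"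
    and ratio: "\<And>v c. v \<in> U \<Longrightarrow> v \<noteq> 0 \<Longrightarrow> scale2 id c v \<in> U \<Longrightarrow> c \<in> range \<iota>"
  shows "scattered \<iota> U"
  unfolding scattered_def
proof (intro conjI allI impI)
  fix v :: "'l \<times> 'l" assume "v \<noteq> 0"
  interpret vector_space "scale2 \<iota>"
    using assms(1) by (rule vector_space_scale2)
  let ?I = "module.span (scale2 id) {v} \<inter> U"
  obtain w where w: "?I \<subseteq> span {w}"
  proof (cases "?I \<subseteq> {0}")
    case True
    then show ?thesis
      using that[of 0] span_zero by blast
  next
    case False
    then obtain w where wI: "w \<in> ?I" and w0: "w \<noteq> 0" by auto
    then obtain c where c: "w = scale2 id c v" "c \<noteq> 0"
      by (cases "w = 0") (auto simp: span_scale2_id scale2_def prod_eq_iff)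
    have "?I \<subseteq> span {w}"
    proof
      fix u assume uI: "u \<in> ?I"
      then obtain d where d: "u = scale2 id d v"
        by (auto simp: span_scale2_id)
      have u: "u = scale2 id (d / c) w"
        using c d by (simp add: scale2_def)
      then obtain k where "d / c = \<iota> k"
        using ratio[of w "d / c"] uI wI w0 by auto
      then have "u = scale2 \<iota> k w"
        using u by (simp add: scale2_def)
      then show "u \<in> span {w}"
        by (simp add: span_base span_scale)
    qed
    then show ?thesis by (rule that)
  qed
  then show "dim ?I \<le> 1"
    using dim_le_card[of ?I "{w}"] by simp
qed fact

text \<open>Each line carries at most \<open>CARD('k) - 1\<close> nonzero vectors of
  \<open>W\<close>; summed over all lines this stays below what dimension \<open>n + 1\<close> would
  require.\<close>

lemma scattered_dim_le:
  fixes \<iota> :: "'k :: {field,finite} \<Rightarrow> 'l :: {field,finite}"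
  assumes hom: "field_hom \<iota>" and card: "CARD('l) = CARD('k) ^ n" and "n > 1"
    and W: "scattered \<iota> W"
  shows "vector_space.dim (scale2 \<iota>) W \<le> n"
proof (rule ccontr)
  interpret \<iota>: field_hom \<iota> by fact
  interpret vector_space "scale2 \<iota>"
    using hom by (rule vector_space_scale2)
  interpret L: vector_space "scale2 (id :: 'l \<Rightarrow> 'l)"
    by (rule vector_space_scale2_id)
  let ?q = "CARD('k)"
  have q: "?q > 1"
    using card_mono[of UNIV "{0, 1 :: 'k}"] by simp
  have subW: "subspace W" using W by (simp add: scattered_def)
  have line: "card (L.span {v} \<inter> W - {0}) \<le> ?q - 1" if "v \<noteq> 0" for v
  proof -
    have eq: "scale2 \<iota> k w = scale2 id (\<iota> k) w" for k w
      by (simp add: scale2_def)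
    have "subspace (L.span {v})"
      unfolding subspace_def eq by (auto intro: L.span_add L.span_scale L.span_zero)
    then have sub: "subspace (L.span {v} \<inter> W)"
      using subW by (rule subspace_inter)
    have "dim (L.span {v} \<inter> W) \<le> 1"
      using W that unfolding scattered_def by blast
    then have "card (L.span {v} \<inter> W) \<le> ?q ^ 1"
      unfolding card_subspace[OF vector_space_axioms sub] using q by (intro power_increasing) auto
    moreover have "0 \<in> L.span {v} \<inter> W"
      using subspace_0[OF sub] .
    ultimately show ?thesis by (simp add: card_Diff_singleton)
  qed
  \<comment> \<open>One spanning vector for each line through the origin: the vertical line and one
    line per slope.\<close>
  let ?V = "insert (0, 1) (range (Pair 1)) :: ('l \<times> 'l) set"
  have "W - {0} \<subseteq> (\<Union>v\<in>?V. L.span {v} \<inter> W - {0})"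
  proof
    fix w assume w: "w \<in> W - {0}"
    have "\<exists>v\<in>?V. w \<in> L.span {v}"
    proof (cases "fst w = 0")
      case True
      then have "w = scale2 id (snd w) (0, 1)" by (simp add: scale2_def prod_eq_iff)
      then show ?thesis unfolding span_scale2_id by blast
    next
      case False
      then have "w = scale2 id (fst w) (1, snd w / fst w)" by (simp add: scale2_def prod_eq_iff)
      then show ?thesis unfolding span_scale2_id by blast
    qed
    with w show "w \<in> (\<Union>v\<in>?V. L.span {v} \<inter> W - {0})" by blast
  qed
  then have "card (W - {0}) \<le> card (\<Union>v\<in>?V. L.span {v} \<inter> W - {0})"
    by (intro card_mono) auto
  also have "\<dots> \<le> (\<Sum>v\<in>?V. card (L.span {v} \<inter> W - {0}))"
    by (rule card_UN_le) simp
  also have "\<dots> \<le> (\<Sum>v\<in>?V. ?q - 1)"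
    by (intro sum_mono line) (auto simp: zero_prod_def)
  also have "\<dots> = card ?V * (?q - 1)" by simp
  also have "card ?V = Suc (card (range (Pair 1) :: ('l \<times> 'l) set))"
    by (rule card_insert_disjoint) auto
  also have "card (range (Pair 1) :: ('l \<times> 'l) set) = ?q ^ n"
    using card by (simp add: card_image inj_on_def)
  finally have "card W - 1 \<le> Suc (?q ^ n) * (?q - 1)"
    using subspace_0[OF subW] by (simp add: card_Diff_singleton)
  also have "Suc (?q ^ n) * (?q - 1) = ?q ^ Suc n - ?q ^ n + ?q - 1"
    using q by (simp add: algebra_simps diff_mult_distrib2)
  \<comment> \<open>Restoring the zero vector turns the last \<open>?q - 1\<close> into
    \<open>?q\<close>, which is still less than the subtracted \<open>?q ^ n\<close> as
    \<open>n > 1\<close>.\<close>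
  finally have le: "card W \<le> ?q ^ Suc n - ?q ^ n + ?q"
    using q by linarith
  assume "\<not> dim W \<le> n"
  then have "?q ^ Suc n \<le> card W"
    unfolding card_subspace[OF vector_space_axioms subW] using q by (intro power_increasing) auto
  moreover have "?q ^ 1 < ?q ^ n"
    using q \<open>n > 1\<close> by (simp only: power_strict_increasing)
  moreover have "?q ^ n \<le> ?q ^ Suc n"
    using q by simp
  ultimately show False
    using le by (simp del: power_Suc)
qed

section \<open>Cross-ratios of the six conjugates of an element\<close>

lemma moebius_diff:
  fixes x y a d :: "'a :: field"
  assumes "x \<noteq> a" and "y \<noteq> a"
  shows "(x - d) / (x - a) - (y - d) / (y - a) = (d - a) / ((x - a) * (y - a)) * (x - y)"
  using assms by (simp add: field_simps)

text \<open>In the application \<open>a\<close> is the factor between two vectors of the subspace on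
  one line; the conclusion puts it in the small field.\<close>

lemma cross_ratio_order_six_automorphism:
  fixes \<phi> :: "'a :: field \<Rightarrow> 'a"
  assumes "field_hom \<phi>" and six: "\<And>x. (\<phi> ^^ 6) x = x"
    and t: "\<phi> t = t" "t \<noteq> 0" "t \<noteq> 1" "t\<^sup>2 \<noteq> (t - 1)\<^sup>2" "t\<^sup>2 - t + 1 \<noteq> 0"
    and N: "N = (t\<^sup>2 - t + 1) / (t * (t - 1))"
    and E: "N * (\<phi> a - a) * ((\<phi> ^^ 4) a - (\<phi> ^^ 3) a) = ((\<phi> ^^ 4) a - a) * (\<phi> a - (\<phi> ^^ 3) a)"
  shows "\<phi> a = a"
proof (rule ccontr)
  assume a01: "\<phi> a \<noteq> a"
  interpret \<phi>: field_hom \<phi> by fact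
  define a1 where "a1 = \<phi> a"
  define a2 where "a2 = \<phi> a1"
  define a3 where "a3 = \<phi> a2"
  define a4 where "a4 = \<phi> a3"
  define a5 where "a5 = \<phi> a4"
  have cyc: "\<phi> a = a1" "\<phi> a1 = a2" "\<phi> a2 = a3" "\<phi> a3 = a4" "\<phi> a4 = a5" "\<phi> a5 = a"
    using six[of a] by (simp_all add: a1_def a2_def a3_def a4_def a5_def eval_nat_numeral)
  have t1: "t - 1 \<noteq> 0" using t by simp
  have N0: "N \<noteq> 0" using t N by simp
  have tN: "t * (t - 1) * N = t\<^sup>2 - t + 1"
    using t(2) t1 N by simp
  \<comment> \<open>\<open>N = 1\<close> would mean \<open>1 = 0\<close> after clearing
    denominators. This later allows \<open>N - 1\<close> to be cancelled from the quadratic.\<close>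
  then have N1: "N \<noteq> 1"
    by (auto simp: algebra_simps power2_eq_square)
  have \<phi>N: "\<phi> N = N"
    by (simp add: N t(1) \<phi>.hom_div \<phi>.hom_add \<phi>.hom_minus \<phi>.hom_mult \<phi>.hom_power)
  have E0: "N * (a1 - a) * (a4 - a3) = (a4 - a) * (a1 - a3)"
    using E by (simp add: a1_def a2_def a3_def a4_def eval_nat_numeral)
  have E1: "N * (a2 - a1) * (a5 - a4) = (a5 - a1) * (a2 - a4)"
    using arg_cong[OF E0, of \<phi>] by (simp add: \<phi>.hom_minus \<phi>.hom_mult \<phi>N cyc)
  have E2: "N * (a3 - a2) * (a - a5) = (a - a2) * (a3 - a5)"
    using arg_cong[OF E1, of \<phi>] by (simp add: \<phi>.hom_minus \<phi>.hom_mult \<phi>N cyc)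
  \<comment> \<open>An equality of neighbouring conjugates could be pushed around the cycle by
    \<open>\<phi>\<close> until it read \<open>\<phi> a = a\<close>.\<close>
  have ne1: "a1 \<noteq> a" "a5 \<noteq> a" "a4 \<noteq> a3"
    using a01 cyc by (metis a1_def)+
  have "a2 \<noteq> a"
  proof
    assume "a2 = a"
    then have "a3 = a1" "a4 = a" using cyc by metis+
    with E0 N0 ne1 show False by simp
  qed
  then have ne2: "a2 \<noteq> a" "a4 \<noteq> a" "a1 \<noteq> a3" "a5 \<noteq> a3" "a2 \<noteq> a3"
    using cyc ne1 by metis+
  have "a3 \<noteq> a"
  proof
    assume a: "a3 = a"
    then have "a4 = a1" using cyc by metis
    with a E0 N1 ne1 show False by simp
  qed
  \<comment> \<open>images under the Moebius map sending \<open>a\<close> to infinity and \<open>a3\<close> to 0\<close>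
  define u where "u = (a1 - a3) / (a1 - a)"
  define u' where "u' = (a4 - a3) / (a4 - a)"
  define v where "v = (a2 - a3) / (a2 - a)"
  define v' where "v' = (a5 - a3) / (a5 - a)"
  note defs = u_def u'_def v_def v'_def
  have nz: "u \<noteq> 0" "u' \<noteq> 0" "v \<noteq> 0" "v' \<noteq> 0"
    using ne1 ne2 by (simp_all add: defs)
  \<comment> \<open>With \<open>a\<close> at infinity and \<open>a3\<close> at 0, the cross-ratios
    \<open>E0\<close> and \<open>E2\<close> become plain quotients.\<close>
  have u: "u = N * u'"
    using E0 ne1 ne2 by (simp add: defs field_simps)
  have v': "v' = N * v"
    using E2 ne1 ne2 by (simp add: defs field_simps)
  \<comment> \<open>The equation \<open>E1\<close> survives the Moebius map: by
    \<open>moebius_diff\<close>, both sides acquire the same factor.\<close>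
  have "N * (v - u) * (v' - u') = (v' - u) * (v - u')"
  proof -
    have "N * (v - u) * (v' - u') =
        (a3 - a)\<^sup>2 / ((a1 - a) * (a2 - a) * (a4 - a) * (a5 - a)) * (N * (a2 - a1) * (a5 - a4))"
      using ne1 ne2 by (simp add: defs moebius_diff power2_eq_square mult_ac)
    also have "\<dots> = (v' - u) * (v - u')"
      unfolding E1 using ne1 ne2 by (simp add: defs moebius_diff power2_eq_square mult_ac)
    finally show ?thesis .
  qed
  then have "N * ((N - 1) * (v\<^sup>2 + u'\<^sup>2 - (N + 1) * u' * v)) = 0"
    unfolding u v' by (simp add: algebra_simps power2_eq_square)
  then have quad: "v\<^sup>2 + u'\<^sup>2 - (N + 1) * u' * v = 0"
    using N0 N1 by simp
  \<comment> \<open>The form of \<open>N\<close> makes the quadratic split, with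
    \<open>v / u'\<close> equal to \<open>t / (t - 1)\<close> or its inverse.\<close>
  have "((t - 1) * v - t * u') * (t * v - (t - 1) * u')
      = t * (t - 1) * (v\<^sup>2 + u'\<^sup>2) - (t * (t - 1) + (t\<^sup>2 - t + 1)) * u' * v"
    by (simp add: algebra_simps power2_eq_square)
  also have "\<dots> = t * (t - 1) * (v\<^sup>2 + u'\<^sup>2 - (N + 1) * u' * v)"
    unfolding tN[symmetric] by (simp add: algebra_simps)
  finally have fact: "((t - 1) * v - t * u') * (t * v - (t - 1) * u') = 0"
    by (simp add: quad)
  \<comment> \<open>The third iterate of \<open>\<phi>\<close> exchanges \<open>a\<close> with
    \<open>a3\<close>, so 0 with infinity, and thus inverts coordinates while moving
    \<open>a2\<close> to \<open>a5\<close> and \<open>a4\<close> to \<open>a1\<close>.\<close>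
  have \<phi>3: "\<phi> (\<phi> (\<phi> v)) = 1 / v'" "\<phi> (\<phi> (\<phi> u')) = 1 / u"
    by (simp_all add: defs \<phi>.hom_div \<phi>.hom_minus cyc)
  have "r * u' = s * v" if "r * v = s * u'" "\<phi> r = r" "\<phi> s = s" for r s
  proof -
    have "\<phi> (\<phi> (\<phi> (r * v))) = \<phi> (\<phi> (\<phi> (s * u')))"
      using that by simp
    then have "r / v' = s / u"
      using that(2,3) \<phi>3 by (simp add: \<phi>.hom_mult)
    then have "N * (r * u') = N * (s * v)"
      using nz by (simp add: u v' field_simps)
    then show ?thesis using N0 by simp
  qed
  note swap = this
  have \<phi>t: "\<phi> (t - 1) = t - 1" by (simp add: t(1) \<phi>.hom_minus)
  \<comment> \<open>Multiplying the relation by its image under the third iterate cancels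
    \<open>u'\<close> and \<open>v\<close>; for \<open>r\<close> and \<open>s\<close> taken to be
    \<open>t\<close> and \<open>t - 1\<close> this contradicts the choice of
    \<open>t\<close>.\<close>
  have no: "r\<^sup>2 = s\<^sup>2" if "r * v = s * u'" "\<phi> r = r" "\<phi> s = s" for r s
  proof -
    have "(r * v) * (r * u') = (s * u') * (s * v)"
      using that swap[OF that] by simp
    then have "(r\<^sup>2 - s\<^sup>2) * (u' * v) = 0"
      by (simp add: algebra_simps power2_eq_square)
    then show ?thesis using nz by simp
  qed
  from fact have "(t - 1) * v = t * u' \<or> t * v = (t - 1) * u'" by simp
  then show False
    using no[OF _ \<phi>t t(1)] no[OF _ t(1) \<phi>t] t(4) by auto
qed

section \<open>Choice of the coefficient and verification for the resulting subspace\<close>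

theorem theorem7p1:
  fixes q :: nat
    and \<iota> :: "'fq::{field,finite} \<Rightarrow> 'fq6::{field,finite}"
    and \<kappa> :: "'fq2::{field,finite} \<Rightarrow> 'fq6"
  assumes "primepow q" and "q > 4"
    and "CARD('fq) = q" and "CARD('fq2) = q ^ 2" and "CARD('fq6) = q ^ 6"
    and "field_hom \<iota>" and "field_hom \<kappa>"
  shows "\<exists>b \<in> range \<kappa> - {0}.
           maximum_scattered \<iota> {(x, b * x ^ q + x ^ (q ^ 4)) | x. True}"
proof -
  define \<phi> :: "'fq6 \<Rightarrow> 'fq6" where "\<phi> = (\<lambda>x. x ^ q)"
  interpret \<phi>: field_hom \<phi>
    unfolding \<phi>_def using assms(1,5) by (rule field_hom_power_primepow)
  interpret \<iota>: field_hom \<iota> by fact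
  interpret vector_space "scale2 \<iota>"
    using assms(6) by (rule vector_space_scale2)
  have iter: "(\<phi> ^^ n) x = x ^ (q ^ n)" for n x
    by (induction n) (simp_all add: \<phi>_def mult.commute flip: power_mult)
  have six: "(\<phi> ^^ 6) x = x" for x
    using power_CARD_eq_self[of x] assms(5) by (simp add: iter)
  have range\<iota>: "range \<iota> = {x. \<phi> x = x}"
    using range_field_hom_eq_power_fixed[OF assms(6)] assms(3) by (simp add: \<phi>_def)
  \<comment> \<open>Choosing the parameter in the small field makes its image \<open>t\<close>, and
    hence \<open>N\<close>, fixed by \<open>\<phi>\<close>; so \<open>N\<close> is a norm and yields
    \<open>b\<close>.\<close>
  obtain t0 :: 'fq where t0: "t0 \<noteq> 0" "t0 \<noteq> 1" "t0\<^sup>2 \<noteq> (t0 - 1)\<^sup>2" "t0\<^sup>2 - t0 + 1 \<noteq> 0"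
    using exists_norm_parameter assms(2,3) by metis
  define t where "t = \<iota> t0"
  have "\<phi> t = t" using range\<iota> t_def by auto
  moreover have "t \<noteq> 0" "t \<noteq> 1"
    using t0 by (simp_all add: t_def)
  moreover have "t\<^sup>2 \<noteq> (t - 1)\<^sup>2"
    using t0(3) unfolding t_def by (metis \<iota>.hom_minus \<iota>.hom_one \<iota>.hom_power \<iota>.eq_iff)
  moreover have "t\<^sup>2 - t + 1 \<noteq> 0"
    using t0(4) unfolding t_def by (metis \<iota>.hom_add \<iota>.hom_minus \<iota>.hom_one \<iota>.hom_power \<iota>.hom_0_iff)
  ultimately have t: "\<phi> t = t" "t \<noteq> 0" "t \<noteq> 1" "t\<^sup>2 \<noteq> (t - 1)\<^sup>2" "t\<^sup>2 - t + 1 \<noteq> 0" .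
  define N where "N = (t\<^sup>2 - t + 1) / (t * (t - 1))"
  have N0: "N \<noteq> 0" using t by (simp add: N_def)
  have "\<phi> N = N"
    by (simp add: N_def t(1) \<phi>.hom_div \<phi>.hom_add \<phi>.hom_minus \<phi>.hom_mult \<phi>.hom_power)
  then obtain b where b: "b \<in> range \<kappa>" "b ^ (q + 1) = N"
    using norm_surjective[OF assms(7,4) _ N0] by (auto simp: \<phi>_def)
  have b0: "b \<noteq> 0" using b N0 by auto
  have b2: "\<phi> (\<phi> b) = b"
    using range_field_hom_eq_power_fixed[OF assms(7)] b(1) assms(4)
    by (auto simp: \<phi>_def power2_eq_square simp flip: power_mult)
  have bN: "b * \<phi> b = N" using b(2) by (simp add: \<phi>_def)
  define f where "f x = b * \<phi> x + (\<phi> ^^ 4) x" for x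
  define U where "U = range (\<lambda>x. (x, f x))"
  have U: "U = {(x, b * x ^ q + x ^ (q ^ 4)) | x. True}"
    by (auto simp: U_def f_def iter) (simp_all add: \<phi>_def)
  have \<phi>4: "(\<phi> ^^ 4) x = \<phi> (\<phi> (\<phi> (\<phi> x)))" for x by (simp add: eval_nat_numeral)
  have \<phi>\<iota>: "\<phi> (\<iota> c) = \<iota> c" for c using range\<iota> by auto
  have f_add: "f (x + y) = f x + f y" for x y
    by (simp add: f_def \<phi>4 \<phi>.hom_add algebra_simps)
  have f_scale: "f (\<iota> c * x) = \<iota> c * f x" for c x
    by (simp add: f_def \<phi>4 \<phi>.hom_mult \<phi>\<iota> algebra_simps)
  have f0: "f 0 = 0" by (simp add: f_def \<phi>4)
  have sub: "subspace U"
    unfolding subspace_def U_def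
    by (auto simp: scale2_def zero_prod_def f0 f_add f_scale)
  have "scattered \<iota> U"
    using assms(6) sub
  proof (rule scatteredI)
    fix v c assume vU: "v \<in> U" "v \<noteq> 0" "scale2 id c v \<in> U"
    then obtain x where x: "v = (x, f x)" by (auto simp: U_def)
    with vU have x0: "x \<noteq> 0" by (auto simp: f0 zero_prod_def)
    have "f (c * x) = c * f x"
      using vU(3) x by (auto simp: U_def scale2_def)
    then have *: "b * \<phi> x * (\<phi> c - c) = - ((\<phi> ^^ 4) x * ((\<phi> ^^ 4) c - c))"
      by (simp add: f_def \<phi>4 \<phi>.hom_mult algebra_simps)
    \<comment> \<open>This is the third iterate of \<open>\<phi>\<close> applied to
      \<open>*\<close>. As \<open>b\<close> has period 2 and \<open>x\<close> period 6, the factors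
      \<open>\<phi> x\<close> and \<open>(\<phi> ^^ 4) x\<close> merely trade places, so they cancel
      in the product of the two equations.\<close>
    have **: "\<phi> b * (\<phi> ^^ 4) x * ((\<phi> ^^ 4) c - (\<phi> ^^ 3) c) = - (\<phi> x * (\<phi> c - (\<phi> ^^ 3) c))"
    proof -
      have "\<phi> (\<phi> (\<phi> (\<phi> (\<phi> (\<phi> (\<phi> y)))))) = \<phi> y" for y
        using arg_cong[OF six[of y], of \<phi>] by (simp add: eval_nat_numeral)
      then show ?thesis
        using arg_cong[OF *, of "\<lambda>y. \<phi> (\<phi> (\<phi> y))"]
        by (simp add: \<phi>.hom_mult \<phi>.hom_minus \<phi>.hom_uminus b2 eval_nat_numeral)
    qed
    have "(\<phi> x * (\<phi> ^^ 4) x) * (N * (\<phi> c - c) * ((\<phi> ^^ 4) c - (\<phi> ^^ 3) c))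
        = (b * \<phi> x * (\<phi> c - c)) * (\<phi> b * (\<phi> ^^ 4) x * ((\<phi> ^^ 4) c - (\<phi> ^^ 3) c))"
      by (simp add: bN[symmetric] mult_ac)
    also have "\<dots> = (\<phi> x * (\<phi> ^^ 4) x) * (((\<phi> ^^ 4) c - c) * (\<phi> c - (\<phi> ^^ 3) c))"
      unfolding * ** by (simp add: mult_ac)
    finally have "N * (\<phi> c - c) * ((\<phi> ^^ 4) c - (\<phi> ^^ 3) c) = ((\<phi> ^^ 4) c - c) * (\<phi> c - (\<phi> ^^ 3) c)"
      using x0 by (simp add: \<phi>4)
    then have "\<phi> c = c"
      by (rule cross_ratio_order_six_automorphism[OF \<phi>.field_hom_axioms six t N_def])
    then show "c \<in> range \<iota>" by (simp add: range\<iota>)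
  qed
  moreover have "dim U = 6"
  proof -
    \<comment> \<open>\<open>U\<close> is the graph of a function on the large field, so its
      dimension can be read off its cardinality.\<close>
    have "card U = q ^ 6"
      using assms(5) by (simp add: U_def card_image inj_on_def)
    then have "q ^ dim U = q ^ 6"
      using card_subspace[OF vector_space_axioms sub] assms(3) by simp
    then show ?thesis
      using assms(2) by (simp add: power_inject_exp)
  qed
  moreover have "dim W \<le> 6" if "scattered \<iota> W" for W
    using scattered_dim_le[OF assms(6) _ _ that, of 6] assms(3,5) by simp
  ultimately have "maximum_scattered \<iota> U"
    by (simp add: maximum_scattered_def)
  then show ?thesis
    using b(1) b0 unfolding U by blast
qed

end
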